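(* Let $D\subseteq\mathbb{C}$ be open, let $\varphi_1,\varphi_2,\psi$ be analytic functions on $D$, let $\alpha,\beta\in\mathbb{R}^{+}\setminus\{1\}$, and for $n=0,1,2,\dots$ let $\Theta_n(x)=\alpha^{\varphi_1(x)}\frac{d^n}{dx^n}\left(\psi(x)\beta^{-\varphi_2(x)}\right)$. Then for every $x\in D$ and all $t$ with $|t|$ sufficiently small (depending on $x$), $$\sum_{n=0}^{\infty}\frac{\Theta_n(x)}{n!}t^n=\alpha^{\varphi_1(x)}\,\psi(x+t)\,\beta^{-\varphi_2(x+t)}.$$
   Context: For $c>0$ and $w\in\mathbb{C}$, $c^{w}=e^{w\ln c}$ with $\ln$ the real natural logarithm. *)

theory Defs
  imports "HOL-Analysis.Analysis"
begin

(* For a positive real base, the library's complex powr is c^w = e^(w ln c)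
   with ln the real natural logarithm. *)
lemma complex_powr_pos_real_base:
  fixes c :: real and w :: complex
  assumes "c > 0"
  shows "complex_of_real c powr w = exp (w * complex_of_real (ln c))"
  using assms by (simp add: powr_def Ln_of_real)

definition Theta ::
  "real \<Rightarrow> real \<Rightarrow> (complex \<Rightarrow> complex) \<Rightarrow> (complex \<Rightarrow> complex) \<Rightarrow> (complex \<Rightarrow> complex)
    \<Rightarrow> nat \<Rightarrow> complex \<Rightarrow> complex" where
  "Theta \<alpha> \<beta> \<phi>1 \<phi>2 \<psi> n x =
     complex_of_real \<alpha> powr \<phi>1 x *
     (deriv ^^ n) (\<lambda>z. \<psi> z * complex_of_real \<beta> powr (- \<phi>2 z)) x"

end

theory Submission
  imports Defs "HOL-Complex_Analysis.Cauchy_Integral_Formula"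
begin

text \<open>For fixed x the factor \<alpha>^\<phi>1(x) is constant in t, so the claim is a constant
  multiple of the Taylor expansion about x of \<open>f\<close>, the product of \<psi> and
  \<beta>^(-\<phi>2), evaluated at x + t. Since \<open>f\<close> is holomorphic on the open set D,
  Cauchy's theory (\<open>holomorphic_power_series\<close>) makes this series converge to
  \<open>f\<close> on every ball about x inside D.\<close>

theorem theorem1:
  fixes D :: "complex set" and \<phi>1 \<phi>2 \<psi> :: "complex \<Rightarrow> complex" and \<alpha> \<beta> :: real
  assumes "open D"
    and "\<phi>1 analytic_on D" and "\<phi>2 analytic_on D" and "\<psi> analytic_on D"
    and "\<alpha> > 0" and "\<alpha> \<noteq> 1" and "\<beta> > 0" and "\<beta> \<noteq> 1"
  shows "\<forall>x\<in>D. \<exists>r>0. \<forall>t::complex. norm t < r \<longrightarrow>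
           x + t \<in> D \<and>
           (\<lambda>n. Theta \<alpha> \<beta> \<phi>1 \<phi>2 \<psi> n x / fact n * t ^ n) sums
             (complex_of_real \<alpha> powr \<phi>1 x * \<psi> (x + t) * complex_of_real \<beta> powr (- \<phi>2 (x + t)))"
proof
  fix x assume "x \<in> D"
  define f where "f = (\<lambda>z. \<psi> z * complex_of_real \<beta> powr (- \<phi>2 z))"
  have "\<phi>2 holomorphic_on D" "\<psi> holomorphic_on D"
    using assms by (auto intro: analytic_imp_holomorphic)
  \<comment> \<open>For \<beta> > 0 the power is the entire function exp composed with a real
    multiple of \<phi>2, so holomorphy follows without any concern for branch cuts of
    \<open>powr\<close>.\<close>
  then have "(\<lambda>z. \<psi> z * exp (- \<phi>2 z * complex_of_real (ln \<beta>))) holomorphic_on D"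
    by (intro holomorphic_intros)
  then have hol: "f holomorphic_on D"
    by (simp add: f_def complex_powr_pos_real_base[OF \<open>\<beta> > 0\<close>])
  \<comment> \<open>The radius of any such ball serves as the bound on t.\<close>
  from \<open>open D\<close> \<open>x \<in> D\<close> obtain r where r: "r > 0" "ball x r \<subseteq> D"
    using openE by blast
  have "x + t \<in> D \<and>
      (\<lambda>n. Theta \<alpha> \<beta> \<phi>1 \<phi>2 \<psi> n x / fact n * t ^ n) sums
        (complex_of_real \<alpha> powr \<phi>1 x * \<psi> (x + t) * complex_of_real \<beta> powr (- \<phi>2 (x + t)))"
    if "norm t < r" for t
  proof
    have t: "x + t \<in> ball x r"
      using that by (simp add: dist_norm)
    then show "x + t \<in> D"
      using r by blast
    \<comment> \<open>The increment \<open>x + t - x\<close> is the library's point minus centre;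
      the final simplification reduces it to t.\<close>
    have "(\<lambda>n. (deriv ^^ n) f x / fact n * (x + t - x) ^ n) sums f (x + t)"
      using holomorphic_power_series[OF holomorphic_on_subset[OF hol r(2)] t] .
    \<comment> \<open>Scaling termwise turns the Taylor coefficients of \<open>f\<close> into
      \<open>Theta\<close> over \<open>fact n\<close>, because \<open>Theta\<close> carries the
      factor at x and not at x + t.\<close>
    from sums_mult[OF this, of "complex_of_real \<alpha> powr \<phi>1 x"]
    show "(\<lambda>n. Theta \<alpha> \<beta> \<phi>1 \<phi>2 \<psi> n x / fact n * t ^ n) sums
        (complex_of_real \<alpha> powr \<phi>1 x * \<psi> (x + t) * complex_of_real \<beta> powr (- \<phi>2 (x + t)))"
      by (simp add: Theta_def f_def mult.assoc)
  qed
  with r(1) show "\<exists>r>0. \<forall>t::complex. norm t < r \<longrightarrow>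
           x + t \<in> D \<and>
           (\<lambda>n. Theta \<alpha> \<beta> \<phi>1 \<phi>2 \<psi> n x / fact n * t ^ n) sums
             (complex_of_real \<alpha> powr \<phi>1 x * \<psi> (x + t) * complex_of_real \<beta> powr (- \<phi>2 (x + t)))"
    by blast
qed

end
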